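(* Let $C_1$ and $C_2$ be circles in the hyperbolic plane $\mathbb{H}^2$ (of curvature $-1$) with hyperbolic radii $R_1>0$ and $R_2>0$ respectively, that are either (a) two gears attached to each other, moving by rotation movements with time domain $\{0,\dots,s\}$ that correspond to each other under the attachment, or (b) two pulleys attached by a tensioned belt, moving by corresponding rotation movements with time domain $[0,s]$. Let $\omega_i(t)$ be the angular velocity of $C_i$ at time $t$. Then $$\sinh(R_1)\,\omega_1(t)=\sinh(R_2)\,\omega_2(t)$$ for every $t\in\{1,\dots,s\}$ in case (a), and for every $t\in[0,s]$ in case (b).
   Context: Let $X=\mathbb{H}^2$; $Isom(X)$ is its isometry group, and a rotation with center $c$ is an orientation-preserving isometry fixing $c$. GEARS. A gear is a geometric circumference $C$ in $X$ with center $c$, together with a division of $C$ into finitely many arcs $\{T^1,\dots,T^n\}$ (with endpoints) of the same length, written in cyclic order; the arcs are the teeth of $C$, and their order gives an orientation of $C$. A rotation movement of a gear is a map $(r,f):\{0,\dots,s\}\to Isom(X)\times\mathbb{Z}$ ($s$ a positive integer) with $r(0)=id_X$, $f(0)=0$, and such that for each $t$, $r(t)$ is a rotation with center $c$ that maps every tooth of $C$ to a tooth of $C$ (so its angle is an integer multiple of $2\pi/n$). The associated winding map is $\sigma(t)=\frac{\delta(p,r(t)(p))}{2\pi/n}+n f(t)\in\mathbb{Z}$, where $p\in C$ is any point (the value does not depend on $p$) and $\delta(p,r(t)(p))\in[0,2\pi)$ is the oriented angle at $c$, with respect to the orientation of $C$, from the geodesic segment $\overline{c,p}$ to $\overline{c,r(t)(p)}$.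 The angular velocity of the gear is $\omega(t)=\frac{2\pi\sigma(t)}{n t}$ for $t\ne0$. Two gears whose teeth have the same arc length are attached if every rotation movement of one gear is transferred to a rotation movement of the other (with the same time domain) having the same associated winding map. PULLEYS. A pulley is a geometric circle $C$ in $X$, with center $c$. A rotation movement of a pulley is a differentiable map $r:[0,s]\to Isom(X)$ ($s>0$) with $r(0)=id_X$ and such that each $r(t)$ is a rotation with center $c$. For $p\in X$ put $r_p(t)=r(t)(p)$. The linear velocity of a differentiable path $\gamma:[0,s]\to X$ is $\gamma'$, with norm $\|\gamma'(t)\|_{\gamma(t)}$ given by the Riemannian metric. For a point $p\in X$ not on $\gamma$ and a geodesic segment $\lambda$ starting at $p$, let $\alpha_{p,\lambda}(\gamma)(t)\in\mathbb{R}$ be the oriented angle at $p$ from $\lambda$ to the geodesic segment $\overline{p,\gamma(t)}$, chosen continuously in $t$; the angular velocity of $\gamma$ with respect to $p$ is $\omega_p(\gamma)(t)=|\alpha_{p,\lambda}(\gamma)'(t)|$ (independent of $\lambda$). The angular velocity of the pulley $C$ under the movement $r$ is $\omega(t)=\omega_c(r_p)(t)$ for any $p\in C$ (independent of $p$). Two pulleys attached by a tensioned belt, with no sliding, means: the rotation movements $r_1,r_2$ of $C_1,C_2$ on $[0,s]$ have linear velocities of the same norm at all times, i.e. $\|(r_1)_{p_1}'(t)\|=\|(r_2)_{p_2}'(t)\|$ for all $t\in[0,s]$, $p_1\in C_1$, $p_2\in C_2$. *)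

theory Defs
  imports "HOL-Complex_Analysis.Complex_Analysis"
begin

(* The hyperbolic plane of curvature -1 is the Poincare disc: the open unit disc with the
   conformal metric 4 |dz|^2 / (1 - |z|^2)^2.  Since the model is conformal, hyperbolic angles
   between tangent vectors are Euclidean angles.  Maps of the plane to itself are represented by
   total functions on complex numbers whose values outside the disc are irrelevant. *)

definition hplane :: "complex set" where
  "hplane = ball 0 1"

definition hdist :: "complex \<Rightarrow> complex \<Rightarrow> real" where
  "hdist z w = arcosh (1 + 2 * (cmod (z - w))\<^sup>2 / ((1 - (cmod z)\<^sup>2) * (1 - (cmod w)\<^sup>2)))"

(* hnorm z v is the Riemannian norm of the tangent vector v at the point z. *)
definition hnorm :: "complex \<Rightarrow> complex \<Rightarrow> real" where
  "hnorm z v = 2 * cmod v / (1 - (cmod z)\<^sup>2)"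

definition hlength :: "real \<Rightarrow> real \<Rightarrow> (real \<Rightarrow> complex) \<Rightarrow> real" where
  "hlength a b \<gamma> = integral {a..b} (\<lambda>x. hnorm (\<gamma> x) (vector_derivative \<gamma> (at x)))"

definition hcircle :: "complex \<Rightarrow> real \<Rightarrow> complex set" where
  "hcircle c R = {z \<in> hplane. hdist c z = R}"

definition hisometry :: "(complex \<Rightarrow> complex) \<Rightarrow> bool" where
  "hisometry g \<longleftrightarrow> bij_betw g hplane hplane \<and>
     (\<forall>z\<in>hplane. \<forall>w\<in>hplane. hdist (g z) (g w) = hdist z w)"

(* Positive Jacobian determinant; isometries of the plane are automatically smooth. *)
definition orientation_preserving :: "(complex \<Rightarrow> complex) \<Rightarrow> bool" where
  "orientation_preserving g \<longleftrightarrow>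
     (\<forall>z\<in>hplane. \<exists>D. (g has_derivative D) (at z) \<and>
        Re (D 1) * Im (D \<i>) - Im (D 1) * Re (D \<i>) > 0)"

definition hrotation :: "complex \<Rightarrow> (complex \<Rightarrow> complex) \<Rightarrow> bool" where
  "hrotation c g \<longleftrightarrow> hisometry g \<and> orientation_preserving g \<and> g c = c"

(* Geodesic segments are parametrised on [0,1] with constant speed. *)
definition geodesic_segment :: "complex \<Rightarrow> complex \<Rightarrow> (real \<Rightarrow> complex) \<Rightarrow> bool" where
  "geodesic_segment p q l \<longleftrightarrow> l ` {0..1} \<subseteq> hplane \<and> l 0 = p \<and> l 1 = q \<and>
     (\<forall>x\<in>{0..1}. \<forall>y\<in>{0..1}. hdist (l x) (l y) = \<bar>x - y\<bar> * hdist p q)"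

(* The segment between two points of the plane is unique. *)
definition the_segment :: "complex \<Rightarrow> complex \<Rightarrow> real \<Rightarrow> complex" where
  "the_segment p q = (SOME l. geodesic_segment p q l)"

definition initial_direction :: "(real \<Rightarrow> complex) \<Rightarrow> complex" where
  "initial_direction l = sgn (vector_derivative l (at 0 within {0..1}))"

(* Counterclockwise angle in [0, 2 pi) from the segment l to the segment m, which have the same
   starting point. *)
definition ccw_angle :: "(real \<Rightarrow> complex) \<Rightarrow> (real \<Rightarrow> complex) \<Rightarrow> real" where
  "ccw_angle l m = Arg2pi (initial_direction m / initial_direction l)"


section \<open>Gears\<close>

(* The teeth are cut out of a simple closed parametrisation of the circle at the parameters
   gcut G 0 = 0 < gcut G 1 < ... < gcut G n = 1.  The parametrisation records the cyclic order of
   the teeth together with the orientation of the circle (which for n = 1, 2 is not determined by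
   the teeth as sets).  The teeth are indexed by 0, ..., n - 1. *)
record gear =
  gcenter :: complex
  gradius :: real
  gnum :: nat
  gpath :: "real \<Rightarrow> complex"
  gcut :: "nat \<Rightarrow> real"

definition gcircle :: "gear \<Rightarrow> complex set" where
  "gcircle G = hcircle (gcenter G) (gradius G)"

definition tooth :: "gear \<Rightarrow> nat \<Rightarrow> complex set" where
  "tooth G i = gpath G ` {gcut G i..gcut G (Suc i)}"

definition tooth_length :: "gear \<Rightarrow> nat \<Rightarrow> real" where
  "tooth_length G i = hlength (gcut G i) (gcut G (Suc i)) (gpath G)"

definition is_gear :: "gear \<Rightarrow> bool" where
  "is_gear G \<longleftrightarrow> gcenter G \<in> hplane \<and> gradius G > 0 \<and> gnum G \<ge> 1 \<and>
     valid_path (gpath G) \<and> simple_path (gpath G) \<and>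
     pathfinish (gpath G) = pathstart (gpath G) \<and> path_image (gpath G) = gcircle G \<and>
     gcut G 0 = 0 \<and> gcut G (gnum G) = 1 \<and> strict_mono_on {0..gnum G} (gcut G) \<and>
     (\<forall>i<gnum G. \<forall>j<gnum G. tooth_length G i = tooth_length G j)"

(* Angle at the center from the segment to p to the segment to q, measured in the orientation of
   the circle: counterclockwise if the parametrisation winds +1 times around the center, and
   clockwise if it winds -1 times. *)
definition gear_angle :: "gear \<Rightarrow> complex \<Rightarrow> complex \<Rightarrow> real" where
  "gear_angle G p q =
     (if winding_number (gpath G) (gcenter G) = 1
      then ccw_angle (the_segment (gcenter G) p) (the_segment (gcenter G) q)
      else ccw_angle (the_segment (gcenter G) q) (the_segment (gcenter G) p))"

definition gear_movement ::
  "gear \<Rightarrow> nat \<Rightarrow> (nat \<Rightarrow> complex \<Rightarrow> complex) \<Rightarrow> (nat \<Rightarrow> int) \<Rightarrow> bool" where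
  "gear_movement G s r f \<longleftrightarrow> s > 0 \<and> (\<forall>z\<in>hplane. r 0 z = z) \<and> f 0 = 0 \<and>
     (\<forall>t\<le>s. hrotation (gcenter G) (r t) \<and>
        (\<forall>i<gnum G. \<exists>j<gnum G. r t ` tooth G i = tooth G j))"

(* For a rotation movement the value is an integer and does not depend on the point p. *)
definition gear_winding ::
  "gear \<Rightarrow> (nat \<Rightarrow> complex \<Rightarrow> complex) \<Rightarrow> (nat \<Rightarrow> int) \<Rightarrow> nat \<Rightarrow> real" where
  "gear_winding G r f t =
     (let p = (SOME p. p \<in> gcircle G)
      in gear_angle G p (r t p) / (2 * pi / real (gnum G)) + real (gnum G) * real_of_int (f t))"

definition gear_angular_velocity ::
  "gear \<Rightarrow> (nat \<Rightarrow> complex \<Rightarrow> complex) \<Rightarrow> (nat \<Rightarrow> int) \<Rightarrow> nat \<Rightarrow> real" where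
  "gear_angular_velocity G r f t = 2 * pi * gear_winding G r f t / (real (gnum G) * real t)"

definition corresponding_movements ::
  "gear \<Rightarrow> gear \<Rightarrow> nat \<Rightarrow> (nat \<Rightarrow> complex \<Rightarrow> complex) \<Rightarrow> (nat \<Rightarrow> int)
     \<Rightarrow> (nat \<Rightarrow> complex \<Rightarrow> complex) \<Rightarrow> (nat \<Rightarrow> int) \<Rightarrow> bool" where
  "corresponding_movements G1 G2 s r1 f1 r2 f2 \<longleftrightarrow>
     gear_movement G1 s r1 f1 \<and> gear_movement G2 s r2 f2 \<and>
     (\<forall>t\<le>s. gear_winding G1 r1 f1 t = gear_winding G2 r2 f2 t)"

definition gears_attached :: "gear \<Rightarrow> gear \<Rightarrow> bool" where
  "gears_attached G1 G2 \<longleftrightarrow>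
     (\<forall>i<gnum G1. \<forall>j<gnum G2. tooth_length G1 i = tooth_length G2 j) \<and>
     (\<forall>s r1 f1. gear_movement G1 s r1 f1 \<longrightarrow>
        (\<exists>r2 f2. corresponding_movements G1 G2 s r1 f1 r2 f2)) \<and>
     (\<forall>s r2 f2. gear_movement G2 s r2 f2 \<longrightarrow>
        (\<exists>r1 f1. corresponding_movements G1 G2 s r1 f1 r2 f2))"


section \<open>Pulleys\<close>

(* Differentiability of r as a map into the Lie group of isometries is expressed by
   differentiability of t \<mapsto> r t z for every point z (one-sided at the end points of [0,s]). *)
definition pulley_movement ::
  "complex \<Rightarrow> real \<Rightarrow> (real \<Rightarrow> complex \<Rightarrow> complex) \<Rightarrow> bool" where
  "pulley_movement c s r \<longleftrightarrow> s > 0 \<and> (\<forall>z\<in>hplane. r 0 z = z) \<and>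
     (\<forall>t\<in>{0..s}. hrotation c (r t)) \<and>
     (\<forall>z\<in>hplane. (\<lambda>t. r t z) differentiable_on {0..s})"

definition linear_speed :: "real \<Rightarrow> (real \<Rightarrow> complex) \<Rightarrow> real \<Rightarrow> real" where
  "linear_speed s \<gamma> t = hnorm (\<gamma> t) (vector_derivative \<gamma> (at t within {0..s}))"

definition continuous_angle ::
  "complex \<Rightarrow> (real \<Rightarrow> complex) \<Rightarrow> real \<Rightarrow> (real \<Rightarrow> complex) \<Rightarrow> (real \<Rightarrow> real) \<Rightarrow> bool" where
  "continuous_angle p l s \<gamma> \<alpha> \<longleftrightarrow> continuous_on {0..s} \<alpha> \<and>
     (\<forall>t\<in>{0..s}. initial_direction (the_segment p (\<gamma> t)) = cis (\<alpha> t) * initial_direction l)"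

(* The result does not depend on the reference segment l, nor on the choice of the continuous
   angle function. *)
definition angular_velocity ::
  "complex \<Rightarrow> real \<Rightarrow> (real \<Rightarrow> complex) \<Rightarrow> real \<Rightarrow> real" where
  "angular_velocity p s \<gamma> t =
     (let \<alpha> = (SOME \<alpha>. \<exists>q l. q \<noteq> p \<and> geodesic_segment p q l \<and> continuous_angle p l s \<gamma> \<alpha>)
      in \<bar>vector_derivative \<alpha> (at t within {0..s})\<bar>)"

(* For a rotation movement the value does not depend on the point p of the circle. *)
definition pulley_angular_velocity ::
  "complex \<Rightarrow> real \<Rightarrow> real \<Rightarrow> (real \<Rightarrow> complex \<Rightarrow> complex) \<Rightarrow> real \<Rightarrow> real" where
  "pulley_angular_velocity c R s r t =
     (let p = (SOME p. p \<in> hcircle c R) in angular_velocity c s (\<lambda>t. r t p) t)"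

definition belt_no_sliding ::
  "complex \<Rightarrow> real \<Rightarrow> complex \<Rightarrow> real \<Rightarrow> real \<Rightarrow> (real \<Rightarrow> complex \<Rightarrow> complex)
     \<Rightarrow> (real \<Rightarrow> complex \<Rightarrow> complex) \<Rightarrow> bool" where
  "belt_no_sliding c1 R1 c2 R2 s r1 r2 \<longleftrightarrow>
     (\<forall>t\<in>{0..s}. \<forall>p1\<in>hcircle c1 R1. \<forall>p2\<in>hcircle c2 R2.
        linear_speed s (\<lambda>t. r1 t p1) t = linear_speed s (\<lambda>t. r2 t p2) t)"

end

theory Submission
  imports Defs
begin

text \<open>Both parts rest on one computation. The Moebius map \<open>z \<mapsto> (z - c) / (1 - cnj c * z)\<close> is
  an isometry of the disc that moves the centre \<open>c\<close> to the origin and carries the hyperbolic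
  circle of radius \<open>R\<close> to the Euclidean circle of radius \<open>tanh (R / 2)\<close>. There the metric is the
  Euclidean one times \<open>2 / (1 - (tanh (R / 2))\<^sup>2)\<close>, so a point whose polar angle changes at
  rate \<open>D\<close> has hyperbolic speed \<open>sinh R * \<bar>D\<bar>\<close> (lemma \<open>hnorm_on_hcircle\<close>).

  For pulleys, the angle at the centre between geodesic segments is the difference of the polar
  angles after recentring, because a geodesic issuing from the origin is a Euclidean radius. Hence
  \<open>sinh R\<close> times the angular velocity is the linear speed, and a belt that does not slide equates
  the linear speeds. This applies to the orbit of a point of the circle, since rotations about \<open>c\<close>
  preserve distances to \<open>c\<close>.

  For gears, integrating the same speed once around the circle shows that a gear with \<open>n\<close> teeth
  of length \<open>L\<close> satisfies \<open>n * L = 2 * pi * sinh R\<close> (lemma \<open>tooth_length_total\<close>). So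
  \<open>sinh R\<close> times the angular velocity \<open>2 * pi * \<sigma> / (n * t)\<close> is \<open>L * \<sigma> / t\<close>, in which both the
  tooth length \<open>L\<close> and the winding map \<open>\<sigma>\<close> are common to two attached gears.\<close>

section \<open>Recentring the disc\<close>

abbreviation recenter :: "complex \<Rightarrow> complex \<Rightarrow> complex" where
  "recenter \<equiv> Moebius_function 0"

lemma hplane_iff: "z \<in> hplane \<longleftrightarrow> cmod z < 1"
  by (simp add: hplane_def)

lemma hplane_one_minus_pos: "z \<in> hplane \<Longrightarrow> 1 - (cmod z)\<^sup>2 > 0"
  by (simp add: hplane_iff abs_square_less_1)

lemma recenter_denominator:
  assumes "c \<in> hplane" "z \<in> hplane"
  shows "1 - cnj c * z \<noteq> 0"
proof
  assume "1 - cnj c * z = 0"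
  then have "cmod (cnj c * z) = 1" by simp
  moreover have "cmod (cnj c * z) < 1"
    using assms norm_mult_less[of "cnj c" 1 z 1] by (simp add: hplane_iff)
  ultimately show False by simp
qed

lemma recenter_in_hplane: "c \<in> hplane \<Longrightarrow> z \<in> hplane \<Longrightarrow> recenter c z \<in> hplane"
  using Moebius_function_norm_lt_1 by (simp add: hplane_iff)

lemma recenter_self: "recenter c c = 0"
  by (rule Moebius_function_eq_zero)

lemma uminus_in_hplane: "c \<in> hplane \<Longrightarrow> - c \<in> hplane"
  by (simp add: hplane_iff)

lemma recenter_inverse:
  assumes "c \<in> hplane" "z \<in> hplane"
  shows "recenter (- c) (recenter c z) = z" "recenter c (recenter (- c) z) = z"
  using assms by (auto intro!: Moebius_function_compose simp: hplane_iff)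

lemma one_minus_recenter:
  assumes "c \<in> hplane" "z \<in> hplane"
  shows "1 - (cmod (recenter c z))\<^sup>2 = (1 - (cmod c)\<^sup>2) * (1 - (cmod z)\<^sup>2) / (cmod (1 - cnj c * z))\<^sup>2"
proof -
  have "(cmod (1 - cnj c * z))\<^sup>2 - (cmod (z - c))\<^sup>2 = (1 - (cmod c)\<^sup>2) * (1 - (cmod z)\<^sup>2)"
    unfolding cmod_power2 by (simp add: algebra_simps power2_eq_square)
  then show ?thesis
    using recenter_denominator[OF assms]
    by (simp add: Moebius_function_simple norm_divide power_divide field_simps)
qed

lemma recenter_diff:
  assumes "c \<in> hplane" "z \<in> hplane" "w \<in> hplane"
  shows "recenter c z - recenter c w =
    of_real (1 - (cmod c)\<^sup>2) * (z - w) / ((1 - cnj c * z) * (1 - cnj c * w))"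
proof -
  have "of_real (1 - (cmod c)\<^sup>2) = 1 - c * cnj c"
    by (simp only: of_real_diff of_real_1 complex_norm_square)
  then show ?thesis
    using recenter_denominator[of c z] recenter_denominator[of c w] assms
    by (simp add: Moebius_function_simple divide_simps) (simp add: algebra_simps)
qed

text \<open>The factors \<open>1 - (cmod c)\<^sup>2\<close> and \<open>cmod (1 - cnj c * z)\<close> that recentring brings into
  the difference of two points cancel against those it brings into the conformal factors.\<close>

lemma hdist_recenter:
  assumes "c \<in> hplane" "z \<in> hplane" "w \<in> hplane"
  shows "hdist (recenter c z) (recenter c w) = hdist z w"
proof -
  have pos: "1 - (cmod c)\<^sup>2 > 0" "cmod (1 - cnj c * z) > 0" "cmod (1 - cnj c * w) > 0"
    using hplane_one_minus_pos[OF assms(1)] recenter_denominator[OF assms(1,2)]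
      recenter_denominator[OF assms(1,3)] by simp_all
  have "(cmod (recenter c z - recenter c w))\<^sup>2 =
      (1 - (cmod c)\<^sup>2)\<^sup>2 * (cmod (z - w))\<^sup>2 / ((cmod (1 - cnj c * z))\<^sup>2 * (cmod (1 - cnj c * w))\<^sup>2)"
    using pos unfolding recenter_diff[OF assms]
    by (simp only: norm_divide norm_mult norm_of_real power_divide power_mult_distrib power2_abs)
  then show ?thesis
    unfolding hdist_def one_minus_recenter[OF assms(1,2)] one_minus_recenter[OF assms(1,3)]
    using pos by (simp add: power2_eq_square)
qed

lemma recenter_has_field_derivative:
  assumes "c \<in> hplane" "z \<in> hplane"
  shows "(recenter c has_field_derivative of_real (1 - (cmod c)\<^sup>2) / (1 - cnj c * z)\<^sup>2) (at z within S)"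
proof -
  have "of_real (1 - (cmod c)\<^sup>2) = 1 - c * cnj c"
    by (simp only: of_real_diff of_real_1 complex_norm_square)
  then show ?thesis
    unfolding Moebius_function_simple[abs_def] using recenter_denominator[OF assms]
    by (auto intro!: derivative_eq_intros simp: power2_eq_square algebra_simps)
qed

lemma hnorm_recenter:
  assumes "c \<in> hplane" "z \<in> hplane"
  shows "hnorm (recenter c z) (v * (of_real (1 - (cmod c)\<^sup>2) / (1 - cnj c * z)\<^sup>2)) = hnorm z v"
proof -
  have pos: "1 - (cmod c)\<^sup>2 > 0" "cmod (1 - cnj c * z) > 0"
    using hplane_one_minus_pos[OF assms(1)] recenter_denominator[OF assms] by simp_all
  have "cmod (of_real (1 - (cmod c)\<^sup>2)) = 1 - (cmod c)\<^sup>2"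
    using pos by (simp only: norm_of_real)
  then show ?thesis
    unfolding hnorm_def one_minus_recenter[OF assms] using pos
    by (simp only: norm_mult norm_divide norm_power) (simp add: divide_simps)
qed

lemma continuous_on_recenter: "c \<in> hplane \<Longrightarrow> continuous_on hplane (recenter c)"
  using Moebius_function_holomorphic[of c 0]
  by (simp add: hplane_def holomorphic_on_imp_continuous_on)

section \<open>Distances and geodesics from the centre\<close>

lemma one_minus_tanh_square: "1 - (tanh x)\<^sup>2 = 1 / (cosh x)\<^sup>2" for x :: real
proof -
  have "1 - (tanh x)\<^sup>2 = ((cosh x)\<^sup>2 - (sinh x)\<^sup>2) / (cosh x)\<^sup>2"
    by (simp add: tanh_def power_divide diff_divide_distrib)
  also have "(cosh x)\<^sup>2 - (sinh x)\<^sup>2 = 1"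
    by (simp add: cosh_square_eq)
  finally show ?thesis .
qed

text \<open>This is \<open>cosh\<close> of the hyperbolic distance between two points of a real diameter at signed distances
  \<open>2 * a\<close> and \<open>2 * b\<close> from the origin.\<close>

lemma one_plus_tanh_quotient:
  fixes a b :: real
  shows "1 + 2 * (tanh a - tanh b)\<^sup>2 / ((1 - (tanh a)\<^sup>2) * (1 - (tanh b)\<^sup>2)) = cosh (2 * (a - b))"
proof -
  have "tanh a - tanh b = sinh (a - b) / (cosh a * cosh b)"
    by (simp add: tanh_def sinh_diff field_simps)
  then have "1 + 2 * (tanh a - tanh b)\<^sup>2 / ((1 - (tanh a)\<^sup>2) * (1 - (tanh b)\<^sup>2)) = 1 + 2 * (sinh (a - b))\<^sup>2"
    unfolding one_minus_tanh_square by (simp add: power_divide power_mult_distrib)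
  also have "\<dots> = cosh (2 * (a - b))"
    by (simp only: cosh_double cosh_square_eq)
  finally show ?thesis .
qed

text \<open>The conformal factor \<open>2 / (1 - \<rho>\<^sup>2)\<close> times the Euclidean radius \<open>\<rho>\<close> of the recentred
  circle; this is where \<open>sinh R\<close> comes from.\<close>

lemma sinh_tanh_half: "2 * tanh (x / 2) / (1 - (tanh (x / 2))\<^sup>2) = sinh (x::real)"
  using sinh_double[of "x / 2"] unfolding one_minus_tanh_square
  by (simp add: tanh_def power2_eq_square)

lemma hdist_argument_ge_1:
  assumes "z \<in> hplane" "w \<in> hplane"
  shows "1 + 2 * (cmod (z - w))\<^sup>2 / ((1 - (cmod z)\<^sup>2) * (1 - (cmod w)\<^sup>2)) \<ge> 1"
  using hplane_one_minus_pos[OF assms(1)] hplane_one_minus_pos[OF assms(2)]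
  by (simp del: diff_gt_0_iff_gt)

lemma cosh_hdist:
  assumes "z \<in> hplane" "w \<in> hplane"
  shows "cosh (hdist z w) = 1 + 2 * (cmod (z - w))\<^sup>2 / ((1 - (cmod z)\<^sup>2) * (1 - (cmod w)\<^sup>2))"
  unfolding hdist_def by (rule cosh_arcosh_real[OF hdist_argument_ge_1[OF assms]])

lemma hdist_nonneg: "z \<in> hplane \<Longrightarrow> w \<in> hplane \<Longrightarrow> hdist z w \<ge> 0"
  unfolding hdist_def by (rule arcosh_nonneg_real[OF hdist_argument_ge_1])

lemma hdist_tanh_ray:
  assumes "cmod u = 1"
  shows "hdist (of_real (tanh (a / 2)) * u) (of_real (tanh (b / 2)) * u) = \<bar>a - b\<bar>"
proof -
  have "of_real (tanh (a / 2)) * u - of_real (tanh (b / 2)) * u = of_real (tanh (a / 2) - tanh (b / 2)) * u"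
    by (simp add: algebra_simps)
  then have n: "cmod (of_real (tanh (a / 2)) * u - of_real (tanh (b / 2)) * u) = \<bar>tanh (a / 2) - tanh (b / 2)\<bar>"
    using assms by (simp only: norm_mult norm_of_real mult_1_right)
  have "hdist (of_real (tanh (a / 2)) * u) (of_real (tanh (b / 2)) * u) = arcosh (cosh (a - b))"
    unfolding hdist_def n using one_plus_tanh_quotient[of "a / 2" "b / 2"] assms
    by (simp add: norm_mult algebra_simps diff_divide_distrib)
  also have "\<dots> = \<bar>a - b\<bar>"
    using arcosh_cosh_real[of "\<bar>a - b\<bar>"] by simp
  finally show ?thesis .
qed

lemma hdist_origin:
  assumes "w \<in> hplane"
  shows "cmod w = tanh (hdist 0 w / 2)"
proof -
  have "hdist 0 w \<ge> 0" using assms hdist_nonneg[of 0 w] by (simp add: hplane_iff)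
  define e where "e = hdist 0 w"
  have c: "cosh e = 1 + 2 * (cmod w)\<^sup>2 / (1 - (cmod w)\<^sup>2)"
    unfolding e_def using cosh_hdist[of 0 w] assms by (simp add: hplane_iff)
  have t: "1 + 2 * (tanh (e / 2))\<^sup>2 / (1 - (tanh (e / 2))\<^sup>2) = cosh e"
    using one_plus_tanh_quotient[of "e / 2" 0] by simp
  have "(tanh (e / 2))\<^sup>2 < 1"
    using tanh_real_bounds[of "e / 2"] by (simp add: abs_square_less_1 abs_if)
  then have "(1 + cosh e) * (tanh (e / 2))\<^sup>2 = (1 + cosh e) * (cmod w)\<^sup>2"
    using c t hplane_one_minus_pos[OF assms] by (simp add: field_simps)
  moreover have "1 + cosh e \<noteq> 0"
    using cosh_real_ge_1[of e] by linarith
  ultimately have "(tanh (e / 2))\<^sup>2 = (cmod w)\<^sup>2" by simp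
  then show ?thesis
    using \<open>hdist 0 w \<ge> 0\<close> unfolding e_def by simp
qed

lemma cmod_recenter:
  assumes "c \<in> hplane" "q \<in> hplane"
  shows "cmod (recenter c q) = tanh (hdist c q / 2)"
  using hdist_origin[OF recenter_in_hplane[OF assms]] hdist_recenter[OF assms(1,1,2)]
  by (simp add: recenter_self)

lemma hcircle_recenter:
  assumes "c \<in> hplane" "z \<in> hcircle c R"
  shows "cmod (recenter c z) = tanh (R / 2)" "z \<in> hplane"
  using assms cmod_recenter[of c z] by (auto simp: hcircle_def)

text \<open>Equality in the triangle inequality: the distances of \<open>l x\<close> to both endpoints are prescribed,
  and they force the Euclidean equation \<open>cmod (w - u) = cmod w - cmod u\<close>,
  where \<open>u\<close> and \<open>w\<close> are the recentred \<open>l x\<close> and \<open>q\<close>. So \<open>u\<close> lies on the radius towards \<open>w\<close>.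
  In particular the segment is unique.\<close>

lemma geodesic_segment_polar:
  assumes c: "c \<in> hplane" and l: "geodesic_segment c q l" and x: "x \<in> {0..1}"
  shows "recenter c (l x) = of_real (tanh (x * hdist c q / 2)) * sgn (recenter c q)"
proof -
  define d where "d = hdist c q"
  define u where "u = recenter c (l x)"
  define w where "w = recenter c q"
  have l01: "l 0 = c" "l 1 = q" and lx: "l x \<in> hplane" and q: "q \<in> hplane"
    using l x by (auto simp: geodesic_segment_def)
  have dist: "hdist (l a) (l b) = \<bar>a - b\<bar> * d" if "a \<in> {0..1}" "b \<in> {0..1}" for a b
    using l that unfolding geodesic_segment_def d_def by blast
  have cx: "hdist c (l x) = x * d" and xq: "hdist (l x) q = (1 - x) * d"
    using dist[of 0 x] dist[of x 1] x l01 by auto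
  have u: "cmod u = tanh (x * d / 2)" and w: "cmod w = tanh (d / 2)"
    using cmod_recenter[OF c lx] cmod_recenter[OF c q] cx by (simp_all add: u_def w_def d_def)
  have uw: "u \<in> hplane" "w \<in> hplane"
    using recenter_in_hplane c lx q by (auto simp: u_def w_def)
  have d0: "d \<ge> 0" using hdist_nonneg c q by (simp add: d_def)
  have "hdist u w = (1 - x) * d"
    using hdist_recenter[OF c lx q] xq by (simp add: u_def w_def)
  then have "1 + 2 * (cmod (u - w))\<^sup>2 / ((1 - (cmod u)\<^sup>2) * (1 - (cmod w)\<^sup>2)) = cosh ((1 - x) * d)"
    using cosh_hdist[OF uw] by simp
  also have "\<dots> = cosh (2 * (d / 2 - x * d / 2))"
    by (simp add: algebra_simps)
  also have "\<dots> = 1 + 2 * (cmod w - cmod u)\<^sup>2 / ((1 - (cmod w)\<^sup>2) * (1 - (cmod u)\<^sup>2))"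
    by (simp only: one_plus_tanh_quotient u w)
  also have "(1 - (cmod w)\<^sup>2) * (1 - (cmod u)\<^sup>2) = (1 - (cmod u)\<^sup>2) * (1 - (cmod w)\<^sup>2)"
    by (rule mult.commute)
  finally have "(cmod (u - w))\<^sup>2 = (cmod w - cmod u)\<^sup>2"
    using hplane_one_minus_pos[OF uw(1)] hplane_one_minus_pos[OF uw(2)] by simp
  moreover have "cmod u \<le> cmod w"
    unfolding u w using x d0 mult_right_mono[of x 1 d] by (simp add: tanh_real_le_iff)
  ultimately have "cmod (w - u) = cmod w - cmod u"
    by (simp add: norm_minus_commute)
  then have "cmod (u + (w - u)) = cmod u + cmod (w - u)" by simp
  then have "cmod u *\<^sub>R (w - u) = (cmod w - cmod u) *\<^sub>R u"
    unfolding norm_triangle_eq using \<open>cmod (w - u) = cmod w - cmod u\<close> by simp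
  then have eq: "cmod u *\<^sub>R w = cmod w *\<^sub>R u"
    by (simp add: algebra_simps)
  show ?thesis
  proof (cases "w = 0")
    case True
    then have "u = 0" using \<open>cmod u \<le> cmod w\<close> by simp
    then show ?thesis using True by (simp add: u_def w_def)
  next
    case False
    have "u = (1 / cmod w) *\<^sub>R (cmod w *\<^sub>R u)" using False by simp
    also have "\<dots> = (cmod u / cmod w) *\<^sub>R w" by (simp flip: eq)
    also have "\<dots> = of_real (cmod u) * sgn w" by (simp add: sgn_div_norm scaleR_conv_of_real divide_simps)
    finally have "u = of_real (tanh (x * d / 2)) * sgn w" unfolding u .
    then show ?thesis unfolding u_def w_def d_def .
  qed
qed

lemma recenter_eq_0_iff: "c \<in> hplane \<Longrightarrow> q \<in> hplane \<Longrightarrow> recenter c q = 0 \<longleftrightarrow> q = c"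
  using recenter_denominator[of c q] by (simp add: Moebius_function_simple)

lemma geodesic_segment_exists:
  assumes c: "c \<in> hplane" and q: "q \<in> hplane" and "q \<noteq> c"
  shows "\<exists>l. geodesic_segment c q l"
proof -
  define d where "d = hdist c q"
  define u where "u = sgn (recenter c q)"
  define e where "e x = of_real (tanh (x * d / 2)) * u" for x :: real
  have u: "cmod u = 1"
    using assms recenter_eq_0_iff[OF c q] by (simp add: u_def norm_sgn)
  have e: "e x \<in> hplane" for x
    using u tanh_real_bounds[of "x * d / 2"] by (simp add: e_def hplane_iff norm_mult abs_if)
  have e0: "e 0 = 0" by (simp add: e_def)
  have e1: "e 1 = recenter c q"
    using cmod_recenter[OF c q, symmetric] recenter_eq_0_iff[OF c q] \<open>q \<noteq> c\<close>
    by (simp add: e_def u_def d_def sgn_div_norm scaleR_conv_of_real)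
  have "hdist (recenter (- c) (e x)) (recenter (- c) (e y)) = \<bar>x - y\<bar> * d" for x y
  proof -
    have "hdist (recenter (- c) (e x)) (recenter (- c) (e y)) = hdist (e x) (e y)"
      using hdist_recenter e uminus_in_hplane c by blast
    also have "\<dots> = \<bar>x * d - y * d\<bar>"
      unfolding e_def by (rule hdist_tanh_ray[OF u])
    also have "\<dots> = \<bar>x - y\<bar> * d"
      using hdist_nonneg[OF c q] by (simp add: d_def left_diff_distrib[symmetric] abs_mult)
    finally show ?thesis .
  qed
  moreover have "recenter (- c) (e 0) = c" by (simp add: e0 Moebius_function_of_zero)
  moreover have "recenter (- c) (e 1) = q" by (simp add: e1 recenter_inverse c q)
  moreover have "recenter (- c) (e x) \<in> hplane" for x
    by (simp add: recenter_in_hplane c uminus_in_hplane e)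
  ultimately have "geodesic_segment c q (\<lambda>x. recenter (- c) (e x))"
    by (auto simp: geodesic_segment_def d_def)
  then show ?thesis by blast
qed

text \<open>The derivative of the inverse map at the origin is the positive real number
  \<open>1 - (cmod c)\<^sup>2\<close>, so recentring does not turn directions at \<open>c\<close>. This is what makes angles at
  \<open>c\<close> differences of polar angles.\<close>

lemma initial_direction_geodesic:
  assumes c: "c \<in> hplane" and l: "geodesic_segment c q l" and "q \<noteq> c"
  shows "initial_direction l = sgn (recenter c q)"
proof -
  define d where "d = hdist c q"
  define u where "u = sgn (recenter c q)"
  have q: "q \<in> hplane" using l by (auto simp: geodesic_segment_def)
  have w0: "recenter c q \<noteq> 0" using assms q recenter_eq_0_iff by blast
  then have "tanh (d / 2) > 0"
    using cmod_recenter[OF c q] unfolding d_def by (metis zero_less_norm_iff)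
  then have d: "d > 0" by simp
  define k where "k = 1 - (cmod c)\<^sup>2"
  have k: "k > 0" using hplane_one_minus_pos[OF c] by (simp add: k_def)
  define e where "e x = of_real (tanh (x * d / 2)) * u" for x :: real
  have le: "l x = recenter (- c) (e x)" if "x \<in> {0..1}" for x
  proof -
    have "l x \<in> hplane" using l that by (auto simp: geodesic_segment_def)
    then show ?thesis
      using geodesic_segment_polar[OF c l that] recenter_inverse(1)[OF c]
      by (simp add: e_def u_def d_def) metis
  qed
  have "((\<lambda>x. tanh (x * d / 2)) has_real_derivative d / 2) (at 0 within {0..1})"
    by (auto intro!: derivative_eq_intros)
  then have "(e has_vector_derivative of_real (d / 2) * u) (at 0 within {0..1})"
    unfolding e_def by (intro has_vector_derivative_mult_left has_vector_derivative_of_real)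
  moreover have "(recenter (- c) has_field_derivative of_real k) (at (e 0) within e ` {0..1})"
    using recenter_has_field_derivative[OF uminus_in_hplane[OF c], of 0]
    by (simp add: e_def k_def hplane_iff)
  ultimately have "((recenter (- c) \<circ> e) has_vector_derivative of_real (d / 2) * u * of_real k) (at 0 within {0..1})"
    by (rule field_vector_diff_chain_within)
  then have "(l has_vector_derivative of_real (d / 2) * u * of_real k) (at 0 within {0..1})"
    by (rule has_vector_derivative_transform[rotated 2]) (auto simp: le)
  then have "vector_derivative l (at 0 within {0..1}) = (d / 2 * k) *\<^sub>R u"
    using vector_derivative_within_cbox[of 0 1 0 l] by (simp add: scaleR_conv_of_real mult_ac)
  then show ?thesis
    using d k by (simp add: initial_direction_def u_def sgn_scaleR)
qed

lemma initial_direction_the_segment: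
  assumes "c \<in> hplane" "q \<in> hplane" "q \<noteq> c"
  shows "initial_direction (the_segment c q) = sgn (recenter c q)"
  using initial_direction_geodesic[OF assms(1) _ assms(3)] geodesic_segment_exists[OF assms]
  unfolding the_segment_def by (metis someI_ex)

section \<open>Speed on a circle\<close>

text \<open>A merely continuous choice of the angle is differentiable wherever the path is, because near
  \<open>t\<close> it agrees with \<open>\<alpha> t\<close> plus the imaginary part of the principal logarithm of
  \<open>\<beta> x / \<beta> t\<close>. Its rate then follows from uniqueness of derivatives; this requires
  \<open>t\<close> to be an accumulation point of \<open>S\<close>.\<close>

lemma lifted_angle_derivative:
  fixes \<beta> :: "real \<Rightarrow> complex"
  assumes polar: "\<And>x. x \<in> S \<Longrightarrow> \<beta> x = K * cis (\<alpha> x)" and K: "K \<noteq> 0"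
    and cont: "continuous_on S \<alpha>"
    and deriv: "(\<beta> has_vector_derivative b) (at t within S)"
    and t: "t \<in> S" and nontriv: "at t within S \<noteq> bot"
  obtains D where "(\<alpha> has_real_derivative D) (at t within S)" "cmod b = cmod K * \<bar>D\<bar>"
proof -
  define h where "h x = \<beta> x / \<beta> t" for x
  have \<beta>t: "\<beta> t \<noteq> 0" using polar[OF t] K by simp
  have h: "h x = exp (\<i> * of_real (\<alpha> x - \<alpha> t))" if "x \<in> S" for x
    using polar[OF that] polar[OF t] K by (simp add: h_def cis_conv_exp exp_diff right_diff_distrib)
  have ht: "h t = 1" using \<beta>t by (simp add: h_def)
  have "(h has_vector_derivative b / \<beta> t) (at t within S)"
    using has_vector_derivative_mult_left[OF deriv, of "inverse (\<beta> t)"]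
    by (simp add: h_def[abs_def] divide_inverse)
  moreover have "(Ln has_field_derivative 1) (at (h t) within h ` S)"
    using has_field_derivative_Ln[of "h t"] by (simp add: ht has_field_derivative_at_within)
  ultimately have "((Ln \<circ> h) has_vector_derivative b / \<beta> t * 1) (at t within S)"
    by (rule field_vector_diff_chain_within)
  then have "((\<lambda>x. \<alpha> t + Im (Ln (h x))) has_vector_derivative 0 + Im (b / \<beta> t)) (at t within S)"
    by (intro has_vector_derivative_add has_vector_derivative_const
          bounded_linear.has_vector_derivative[OF bounded_linear_Im])
       (simp add: o_def)
  moreover have "\<forall>\<^sub>F x in at t within S. \<alpha> t + Im (Ln (h x)) = \<alpha> x"
  proof -
    have "(\<alpha> \<longlongrightarrow> \<alpha> t) (at t within S)"
      using cont t by (simp add: continuous_on_def)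
    then have "\<forall>\<^sub>F x in at t within S. dist (\<alpha> x) (\<alpha> t) < pi"
      by (rule tendstoD) simp
    moreover have "\<forall>\<^sub>F x in at t within S. x \<in> S"
      by (simp add: eventually_at_filter)
    ultimately show ?thesis
    proof eventually_elim
      \<comment> \<open>Within \<open>pi\<close> of \<open>\<alpha> t\<close> the principal branch of the logarithm picks the right angle.\<close>
      case (elim x)
      have "Ln (h x) = \<i> * of_real (\<alpha> x - \<alpha> t)"
        unfolding h[OF elim(2)] using elim(1) by (intro Ln_exp) (auto simp: dist_real_def)
      then show ?case by simp
    qed
  qed
  ultimately have "(\<alpha> has_vector_derivative Im (b / \<beta> t)) (at t within S)"
    using ht by (subst (asm) has_vector_derivative_cong_ev) (auto simp: t eventually_at_filter elim!: eventually_mono)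
  then have \<alpha>: "(\<alpha> has_real_derivative Im (b / \<beta> t)) (at t within S)"
    by (simp add: has_real_derivative_iff_has_vector_derivative)
  define D where "D = Im (b / \<beta> t)"
  have "((\<lambda>x. of_real (\<alpha> x)) has_vector_derivative of_real D) (at t within S)"
    using \<alpha> unfolding D_def by (rule has_vector_derivative_of_real)
  moreover have "((\<lambda>z. K * exp (\<i> * z)) has_field_derivative K * exp (\<i> * of_real (\<alpha> t)) * \<i>)
      (at (of_real (\<alpha> t)) within (\<lambda>x. of_real (\<alpha> x)) ` S)"
    by (auto intro!: derivative_eq_intros)
  ultimately have "(((\<lambda>z. K * exp (\<i> * z)) \<circ> (\<lambda>x. of_real (\<alpha> x))) has_vector_derivative
      of_real D * (K * exp (\<i> * of_real (\<alpha> t)) * \<i>)) (at t within S)"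
    by (rule field_vector_diff_chain_within)
  then have "(\<beta> has_vector_derivative of_real D * (K * exp (\<i> * of_real (\<alpha> t)) * \<i>)) (at t within S)"
    by (rule has_vector_derivative_transform[OF t, rotated]) (simp add: polar cis_conv_exp)
  then have "b = of_real D * (K * exp (\<i> * of_real (\<alpha> t)) * \<i>)"
    using vector_derivative_unique_within[OF nontriv deriv] by blast
  then have "cmod b = cmod K * \<bar>D\<bar>"
    by (simp add: norm_mult)
  with \<alpha> that show thesis unfolding D_def by blast
qed

lemma hnorm_on_hcircle:
  assumes c: "c \<in> hplane" and \<gamma>: "\<forall>x\<in>S. \<gamma> x \<in> hplane"
    and polar: "\<forall>x\<in>S. recenter c (\<gamma> x) = K * cis (\<alpha> x)"
    and K: "cmod K = tanh (R / 2)" and R: "R > 0"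
    and cont: "continuous_on S \<alpha>"
    and deriv: "(\<gamma> has_vector_derivative v) (at t within S)"
    and t: "t \<in> S" and nontriv: "at t within S \<noteq> bot"
  obtains D where "(\<alpha> has_real_derivative D) (at t within S)" "hnorm (\<gamma> t) v = sinh R * \<bar>D\<bar>"
proof -
  have \<gamma>t: "\<gamma> t \<in> hplane" using \<gamma> t by blast
  define b where "b = v * (of_real (1 - (cmod c)\<^sup>2) / (1 - cnj c * \<gamma> t)\<^sup>2)"
  have "((recenter c \<circ> \<gamma>) has_vector_derivative b) (at t within S)"
    unfolding b_def using deriv recenter_has_field_derivative[OF c \<gamma>t]
    by (rule field_vector_diff_chain_within)
  moreover have "K \<noteq> 0" using K R by auto
  ultimately obtain D where D: "(\<alpha> has_real_derivative D) (at t within S)" "cmod b = cmod K * \<bar>D\<bar>"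
    using lifted_angle_derivative[of S "recenter c \<circ> \<gamma>" K \<alpha> b t] polar cont t nontriv by auto
  have "hnorm (\<gamma> t) v = hnorm (recenter c (\<gamma> t)) b"
    unfolding b_def by (rule hnorm_recenter[OF c \<gamma>t, symmetric])
  also have "\<dots> = 2 * tanh (R / 2) / (1 - (tanh (R / 2))\<^sup>2) * \<bar>D\<bar>"
    unfolding hnorm_def D(2) bspec[OF polar t] by (simp add: norm_mult K)
  finally show thesis
    using that D(1) by (simp only: sinh_tanh_half)
qed

section \<open>Gears\<close>

text \<open>A continuous polar angle of a simple loop tracing the circle is injective, hence monotone: two parameters with the
  same angle would be the two ends, whose angles differ by \<open>2 * pi\<close> because the winding number is
  \<open>1\<close> or \<open>- 1\<close>. So the loop never turns back, the speed is \<open>sinh R\<close> times the derivative of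
  the angle up to one global sign, and arc length is an increment of the angle. The antiderivative
  \<open>F\<close> makes the lengths of consecutive teeth telescope.\<close>

lemma hcircle_loop_length:
  assumes c: "c \<in> hplane" and R: "R > 0"
    and \<gamma>: "valid_path \<gamma>" "simple_path \<gamma>" "pathfinish \<gamma> = pathstart \<gamma>" "path_image \<gamma> = hcircle c R"
  obtains F where "F 1 - F 0 = 2 * pi * sinh R"
    "\<And>a b. 0 \<le> a \<Longrightarrow> a \<le> b \<Longrightarrow> b \<le> 1 \<Longrightarrow> hlength a b \<gamma> = F b - F a"
proof -
  define \<rho> where "\<rho> = tanh (R / 2)"
  have \<rho>: "0 < \<rho>" "\<rho> < 1" using R by (auto simp: \<rho>_def tanh_real_lt_1)
  define \<beta> where "\<beta> = recenter c \<circ> \<gamma>"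
  have \<gamma>_in: "\<gamma> x \<in> hcircle c R" if "x \<in> {0..1}" for x
    using \<gamma>(4) that by (auto simp: path_image_def)
  note \<gamma>_hplane = hcircle_recenter(2)[OF c \<gamma>_in]
  have circ: "hcircle c R \<subseteq> hplane" by (auto simp: hcircle_def)
  have "inj_on (recenter c) hplane"
    by (rule inj_on_inverseI[of _ "recenter (- c)"]) (simp add: recenter_inverse c)
  then have simple: "simple_path \<beta>"
    unfolding \<beta>_def using \<gamma>(2) continuous_on_recenter[OF c] circ
    by (intro simple_path_continuous_image) (auto simp: \<gamma>(4) intro: continuous_on_subset inj_on_subset)
  have image: "path_image \<beta> = sphere 0 \<rho>"
  proof
    show "path_image \<beta> \<subseteq> sphere 0 \<rho>"
      using hcircle_recenter[OF c] by (auto simp: \<beta>_def path_image_compose \<gamma>(4) \<rho>_def)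
    show "sphere 0 \<rho> \<subseteq> path_image \<beta>"
    proof
      fix w :: complex assume "w \<in> sphere 0 \<rho>"
      then have w: "cmod w = \<rho>" "w \<in> hplane" using \<rho> by (auto simp: hplane_iff)
      define z where "z = recenter (- c) w"
      have z: "z \<in> hplane" "recenter c z = w"
        using w c by (auto simp: z_def recenter_in_hplane uminus_in_hplane recenter_inverse)
      have "tanh (hdist c z / 2) = tanh (R / 2)"
        using cmod_recenter[OF c z(1)] z(2) w(1) by (simp add: \<rho>_def)
      then have "z \<in> hcircle c R" using z(1) by (simp add: hcircle_def)
      then show "w \<in> path_image \<beta>"
        using z(2) by (auto simp: \<beta>_def path_image_compose \<gamma>(4))
    qed
  qed
  have "inside (sphere (0::complex) \<rho>) = ball 0 \<rho>"
    using inside_frontier_eq_interior[of "cball (0::complex) \<rho>"] \<rho> by simp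
  then have wind: "winding_number \<beta> 0 = 1 \<or> winding_number \<beta> 0 = - 1"
    using simple_closed_path_winding_number_inside[OF simple] \<rho> unfolding image
    by (metis centre_in_ball)
  have "0 \<notin> path_image \<beta>" using \<rho> by (simp add: image)
  then obtain q where q: "path q" "pathfinish q - pathstart q = 2 * of_real pi * \<i> * winding_number \<beta> 0"
      "\<And>t. t \<in> {0..1} \<Longrightarrow> \<beta> t = 0 + exp (q t)"
    using winding_number_as_continuous_log[OF simple_path_imp_path[OF simple]] by metis
  define \<theta> where "\<theta> t = Im (q t)" for t
  have polar: "\<beta> t = of_real \<rho> * cis (\<theta> t)" if "t \<in> {0..1}" for t
  proof -
    have "\<beta> t \<in> sphere 0 \<rho>" using that image by (auto simp: path_image_def)
    then have "\<rho> = exp (Re (q t))" using q(3)[OF that] by simp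
    then show ?thesis using q(3)[OF that] by (simp add: exp_eq_polar \<theta>_def)
  qed
  have cont: "continuous_on {0..1} \<theta>"
    using q(1) unfolding \<theta>_def path_def by (intro continuous_intros)
  have total: "\<bar>\<theta> 1 - \<theta> 0\<bar> = 2 * pi"
  proof -
    have "\<theta> 1 - \<theta> 0 = Im (2 * of_real pi * \<i> * winding_number \<beta> 0)"
      by (simp add: \<theta>_def q(2)[symmetric] pathfinish_def pathstart_def)
    then show ?thesis using wind by auto
  qed
  have "inj_on \<theta> {0..1}"
  proof (rule inj_onI)
    fix x y :: real assume xy: "x \<in> {0..1}" "y \<in> {0..1}" "\<theta> x = \<theta> y"
    then have "\<beta> x = \<beta> y" by (simp add: polar)
    then have "x = y \<or> x = 0 \<and> y = 1 \<or> x = 1 \<and> y = 0"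
      using simple xy unfolding simple_path_def loop_free_def by blast
    then show "x = y" using xy(3) total by auto
  qed
  then have "strict_mono_on {0..1} \<theta> \<or> strict_antimono_on {0..1} \<theta>"
    using injective_eq_monotone_map[OF is_interval_cc cont] by blast
  then obtain s where s: "s = 1 \<or> s = - 1" "mono_on {0..1} (\<lambda>t. s * \<theta> t)"
  proof
    assume "strict_mono_on {0..1} \<theta>"
    then show thesis
      by (intro that[of 1]) (simp_all add: strict_mono_on_imp_mono_on)
  next
    assume "strict_antimono_on {0..1} \<theta>"
    then have "mono_on {0..1} (\<lambda>t. (-1) * \<theta> t)"
      by (auto simp: monotone_on_def le_less)
    then show thesis by (intro that[of "-1"]) simp_all
  qed
  obtain E where E: "finite E" "\<And>x. x \<in> {0..1} - E \<Longrightarrow> \<gamma> differentiable at x"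
    using \<gamma>(1) unfolding valid_path_def piecewise_C1_differentiable_on_def C1_differentiable_on_eq
    by blast
  define F where "F t = sinh R * (s * \<theta> t)" for t
  have speed: "(F has_vector_derivative hnorm (\<gamma> x) (vector_derivative \<gamma> (at x))) (at x)"
    if x: "x \<in> {0<..<1} - E" for x
  proof -
    have at: "at x within {0..1} = at x"
      using x by (intro at_within_interior) simp
    have "\<forall>t\<in>{0..1}. \<gamma> t \<in> hplane" using \<gamma>_hplane by blast
    moreover have "\<forall>t\<in>{0..1}. recenter c (\<gamma> t) = of_real \<rho> * cis (\<theta> t)"
      using polar by (simp add: \<beta>_def)
    moreover have "cmod (of_real \<rho>) = tanh (R / 2)" using \<rho> by (simp add: \<rho>_def)
    moreover have "(\<gamma> has_vector_derivative vector_derivative \<gamma> (at x)) (at x within {0..1})"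
      using E(2)[of x] x by (simp add: vector_derivative_works[symmetric] at)
    moreover have "x \<in> {0..1}" "at x within {0..1} \<noteq> bot" using x at by simp_all
    ultimately obtain D where D: "(\<theta> has_real_derivative D) (at x within {0..1})"
        "hnorm (\<gamma> x) (vector_derivative \<gamma> (at x)) = sinh R * \<bar>D\<bar>"
      using hnorm_on_hcircle[OF c _ _ _ R cont] by blast
    have sD: "((\<lambda>t. s * \<theta> t) has_real_derivative s * D) (at x)"
      using D(1) unfolding at by (rule DERIV_cmult)
    have "s * D \<ge> 0"
      using x by (intro mono_on_imp_deriv_nonneg[OF s(2) sD]) simp
    then have "s * D = \<bar>D\<bar>" using s(1) by auto
    then have "(F has_real_derivative sinh R * \<bar>D\<bar>) (at x)"
      unfolding F_def using DERIV_cmult[OF sD, of "sinh R"] by simp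
    then show ?thesis
      by (simp add: D(2) has_real_derivative_iff_has_vector_derivative)
  qed
  show thesis
  proof (rule that)
    have "s * \<theta> 0 \<le> s * \<theta> 1" using s(2) by (rule mono_onD) auto
    then have "s * \<theta> 1 - s * \<theta> 0 = 2 * pi" using total s(1) by auto
    then show "F 1 - F 0 = 2 * pi * sinh R"
      by (simp add: F_def right_diff_distrib[symmetric])
    fix a b :: real assume ab: "0 \<le> a" "a \<le> b" "b \<le> 1"
    have "continuous_on {a..b} F"
      unfolding F_def using ab by (intro continuous_intros continuous_on_subset[OF cont]) auto
    then have "((\<lambda>x. hnorm (\<gamma> x) (vector_derivative \<gamma> (at x))) has_integral F b - F a) {a..b}"
      using ab by (intro fundamental_theorem_of_calculus_interior_strong[OF E(1)] speed) auto
    then show "hlength a b \<gamma> = F b - F a"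
      unfolding hlength_def by (rule integral_unique)
  qed
qed

lemma tooth_length_total:
  assumes G: "is_gear G" and i: "i < gnum G"
  shows "real (gnum G) * tooth_length G i = 2 * pi * sinh (gradius G)"
proof -
  have c: "gcenter G \<in> hplane" and R: "gradius G > 0"
    and \<gamma>: "valid_path (gpath G)" "simple_path (gpath G)" "pathfinish (gpath G) = pathstart (gpath G)"
       "path_image (gpath G) = hcircle (gcenter G) (gradius G)"
    and cut: "gcut G 0 = 0" "gcut G (gnum G) = 1" "strict_mono_on {0..gnum G} (gcut G)"
    and eq: "\<forall>i<gnum G. \<forall>j<gnum G. tooth_length G i = tooth_length G j"
    using G unfolding is_gear_def gcircle_def by blast+
  obtain F where F: "F 1 - F 0 = 2 * pi * sinh (gradius G)"
    "\<And>a b. 0 \<le> a \<Longrightarrow> a \<le> b \<Longrightarrow> b \<le> 1 \<Longrightarrow> hlength a b (gpath G) = F b - F a"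
    using hcircle_loop_length[OF c R \<gamma>] by metis
  have mono: "gcut G j \<le> gcut G k" if "j \<le> k" "k \<le> gnum G" for j k
    using that by (intro mono_onD[OF strict_mono_on_imp_mono_on[OF cut(3)]]) auto
  have "real (gnum G) * tooth_length G i = (\<Sum>j<gnum G. tooth_length G i)"
    by simp
  also have "\<dots> = (\<Sum>j<gnum G. tooth_length G j)"
    using eq i by (intro sum.cong) blast+
  also have "\<dots> = (\<Sum>j<gnum G. F (gcut G (Suc j)) - F (gcut G j))"
  proof (rule sum.cong[OF refl])
    fix j assume "j \<in> {..<gnum G}"
    then show "tooth_length G j = F (gcut G (Suc j)) - F (gcut G j)"
      unfolding tooth_length_def using mono[of 0 j] mono[of j "Suc j"] mono[of "Suc j" "gnum G"] cut
      by (intro F(2)) auto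
  qed
  also have "\<dots> = F 1 - F 0"
    using sum_lessThan_telescope[of "\<lambda>j. F (gcut G j)" "gnum G"] by (simp add: cut)
  finally show ?thesis using F(1) by simp
qed

lemma gear_sinh_angular_velocity:
  assumes "is_gear G" "i < gnum G"
  shows "sinh (gradius G) * gear_angular_velocity G r f t = tooth_length G i * gear_winding G r f t / real t"
proof -
  have "sinh (gradius G) * gear_angular_velocity G r f t =
      2 * pi * sinh (gradius G) * gear_winding G r f t / (real (gnum G) * real t)"
    by (simp add: gear_angular_velocity_def)
  also have "2 * pi * sinh (gradius G) = real (gnum G) * tooth_length G i"
    using tooth_length_total[OF assms] by simp
  finally show ?thesis using assms(2) by simp
qed

section \<open>Pulleys\<close>

lemma hcircle_nonempty:
  assumes c: "c \<in> hplane" and R: "R > 0"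
  shows "hcircle c R \<noteq> {}"
proof -
  have "of_real (tanh (R / 2)) \<in> hplane" 
    using R by (simp add: hplane_iff tanh_real_lt_1)
  then have z: "recenter (- c) (of_real (tanh (R / 2))) \<in> hplane"
      "recenter c (recenter (- c) (of_real (tanh (R / 2)))) = of_real (tanh (R / 2))"
    by (auto simp: recenter_in_hplane uminus_in_hplane recenter_inverse c)
  have "tanh (hdist c (recenter (- c) (of_real (tanh (R / 2)))) / 2) = tanh (R / 2)"
    using cmod_recenter[OF c z(1)] z(2) R by simp
  then show ?thesis using z(1) by (auto simp: hcircle_def)
qed

text \<open>The angular velocity is defined by an arbitrary choice of a reference segment and a continuous
  angle. A continuous logarithm of the recentred path shows that a choice exists, and whatever is
  chosen puts the path into polar form with a constant factor, so the absolute value of its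
  rate of change is determined by the speed.\<close>

lemma linear_speed_eq_angular_velocity:
  assumes c: "c \<in> hplane" and R: "R > 0" and s: "s > 0"
    and \<gamma>: "\<And>t. t \<in> {0..s} \<Longrightarrow> \<gamma> t \<in> hcircle c R" and diff: "\<gamma> differentiable_on {0..s}"
    and t: "t \<in> {0..s}"
  shows "linear_speed s \<gamma> t = sinh R * angular_velocity c s \<gamma> t"
proof -
  define \<beta> where "\<beta> t = recenter c (\<gamma> t)" for t
  define \<rho> where "\<rho> = tanh (R / 2)"
  have \<rho>: "\<rho> > 0" using R by (simp add: \<rho>_def)
  have \<gamma>_hplane: "\<gamma> x \<in> hplane" and \<beta>: "cmod (\<beta> x) = \<rho>" if "x \<in> {0..s}" for x
    using hcircle_recenter[OF c \<gamma>[OF that]] by (auto simp: \<beta>_def \<rho>_def)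
  have \<gamma>_c: "\<gamma> x \<noteq> c" if "x \<in> {0..s}" for x
    using \<beta>[OF that] \<rho> by (auto simp: \<beta>_def recenter_self)
  have dir: "\<beta> x = of_real \<rho> * initial_direction (the_segment c (\<gamma> x))" if "x \<in> {0..s}" for x
    using initial_direction_the_segment[OF c \<gamma>_hplane[OF that] \<gamma>_c[OF that]] \<beta>[OF that] \<rho>
    by (simp add: \<beta>_def[symmetric] sgn_div_norm scaleR_conv_of_real)
  have cont_\<beta>: "continuous_on {0..s} \<beta>"
    unfolding \<beta>_def using \<gamma>_hplane
    by (intro continuous_on_compose2[OF continuous_on_recenter[OF c] differentiable_imp_continuous_on[OF diff]]) auto
  define angle where "angle \<alpha> \<longleftrightarrow> (\<exists>q l. q \<noteq> c \<and> geodesic_segment c q l \<and> continuous_angle c l s \<gamma> \<alpha>)" for \<alpha>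
  have "\<exists>\<alpha>. angle \<alpha>"
  proof -
    have 0: "0 \<in> {0..s}" using s by simp
    have "contractible {0..s}" by (simp add: convex_imp_contractible)
    moreover have "\<beta> z \<noteq> 0" if "z \<in> {0..s}" for z using \<beta>[OF that] \<rho> by auto
    ultimately obtain g where g: "continuous_on {0..s} g" "\<And>x. x \<in> {0..s} \<Longrightarrow> \<beta> x = exp (g x)"
      using continuous_logarithm_on_contractible[OF cont_\<beta>] by metis
    obtain l where l: "geodesic_segment c (\<gamma> 0) l"
      using geodesic_segment_exists[OF c \<gamma>_hplane[OF 0] \<gamma>_c[OF 0]] by blast
    have polar: "\<beta> x = of_real \<rho> * cis (Im (g x))" if "x \<in> {0..s}" for x
    proof -
      have "\<rho> = exp (Re (g x))" using \<beta>[OF that] g(2)[OF that] by simp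
      then show ?thesis using g(2)[OF that] by (simp add: exp_eq_polar)
    qed
    have "initial_direction l = cis (Im (g 0))"
      using initial_direction_geodesic[OF c l \<gamma>_c[OF 0]] polar[OF 0] \<rho>
      by (simp add: \<beta>_def[symmetric] sgn_mult sgn_of_real sgn_div_norm[of "cis _"])
    moreover have "initial_direction (the_segment c (\<gamma> x)) = cis (Im (g x))" if "x \<in> {0..s}" for x
      using dir[OF that] polar[OF that] \<rho> by simp
    ultimately have "continuous_angle c l s \<gamma> (\<lambda>x. Im (g x) - Im (g 0))"
      unfolding continuous_angle_def using g(1) by (auto intro!: continuous_intros simp: cis_mult)
    then show ?thesis unfolding angle_def using l \<gamma>_c[OF 0] by blast
  qed
  then have "angle (SOME \<alpha>. angle \<alpha>)" by (rule someI_ex)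
  then obtain \<alpha> q l where \<alpha>: "\<alpha> = (SOME \<alpha>. angle \<alpha>)"
      "q \<noteq> c" "geodesic_segment c q l" "continuous_angle c l s \<gamma> \<alpha>"
    unfolding angle_def by blast
  define K where "K = of_real \<rho> * initial_direction l"
  have q: "q \<in> hplane" using \<alpha>(3) by (auto simp: geodesic_segment_def)
  have "cmod (initial_direction l) = 1"
    using initial_direction_geodesic[OF c \<alpha>(3,2)] recenter_eq_0_iff[OF c q] \<alpha>(2) by (simp add: norm_sgn)
  then have K: "cmod K = tanh (R / 2)" using \<rho> by (simp add: K_def norm_mult \<rho>_def)
  have polar: "\<forall>x\<in>{0..s}. recenter c (\<gamma> x) = K * cis (\<alpha> x)"
    using dir \<alpha>(4) by (simp add: continuous_angle_def \<beta>_def K_def)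
  have cont: "continuous_on {0..s} \<alpha>" using \<alpha>(4) by (simp add: continuous_angle_def)
  have nontriv: "at t within {0..s} \<noteq> bot"
    using s t by (simp add: trivial_limit_within islimpt_Icc)
  have "(\<gamma> has_vector_derivative vector_derivative \<gamma> (at t within {0..s})) (at t within {0..s})"
    using diff t by (simp add: differentiable_on_def vector_derivative_works[symmetric])
  then obtain D where D: "(\<alpha> has_real_derivative D) (at t within {0..s})"
     "linear_speed s \<gamma> t = sinh R * \<bar>D\<bar>"
    unfolding linear_speed_def
    using hnorm_on_hcircle[OF c _ polar K R cont _ t nontriv] \<gamma>_hplane by blast
  have "vector_derivative \<alpha> (at t within {0..s}) = D"
    using D(1) nontriv by (simp add: has_real_derivative_iff_has_vector_derivative vector_derivative_within)
  then have "angular_velocity c s \<gamma> t = \<bar>D\<bar>"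
    unfolding angular_velocity_def using \<alpha>(1) by (simp add: angle_def[abs_def])
  with D(2) show ?thesis by simp
qed

lemma hrotation_hcircle:
  assumes "c \<in> hplane" "hrotation c g" "z \<in> hcircle c R"
  shows "g z \<in> hcircle c R"
proof -
  have "z \<in> hplane" "hdist c z = R" using assms(3) by (auto simp: hcircle_def)
  moreover have "g c = c" "bij_betw g hplane hplane" 
      "\<And>z w. z \<in> hplane \<Longrightarrow> w \<in> hplane \<Longrightarrow> hdist (g z) (g w) = hdist z w"
    using assms(2) by (auto simp: hrotation_def hisometry_def)
  ultimately show ?thesis
    using assms(1) by (metis (mono_tags, lifting) bij_betwE hcircle_def mem_Collect_eq)
qed

lemma pulley_sinh_angular_velocity:
  assumes c: "c \<in> hplane" and R: "R > 0" and r: "pulley_movement c s r" and t: "t \<in> {0..s}"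
  obtains p where "p \<in> hcircle c R"
    "sinh R * pulley_angular_velocity c R s r t = linear_speed s (\<lambda>t. r t p) t"
proof -
  define p where "p = (SOME p. p \<in> hcircle c R)"
  have p: "p \<in> hcircle c R"
    unfolding p_def using hcircle_nonempty[OF c R] by (simp add: some_in_eq)
  then have "p \<in> hplane" by (simp add: hcircle_def)
  then have "linear_speed s (\<lambda>t. r t p) t = sinh R * angular_velocity c s (\<lambda>t. r t p) t"
    using r p t by (intro linear_speed_eq_angular_velocity[OF c R])
      (auto simp: pulley_movement_def intro: hrotation_hcircle[OF c])
  then show thesis
    using that[OF p] by (simp add: pulley_angular_velocity_def p_def[symmetric])
qed

section \<open>The transmission law\<close>

theorem mainTheorem2:
  fixes c1 c2 :: complex and R1 R2 :: real
  assumes "c1 \<in> hplane" and "c2 \<in> hplane" and "R1 > 0" and "R2 > 0"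
  shows
    "(\<forall>G1 G2 (s::nat) r1 f1 r2 f2.
        is_gear G1 \<and> gcenter G1 = c1 \<and> gradius G1 = R1 \<and>
        is_gear G2 \<and> gcenter G2 = c2 \<and> gradius G2 = R2 \<and>
        gears_attached G1 G2 \<and> corresponding_movements G1 G2 s r1 f1 r2 f2 \<longrightarrow>
        (\<forall>t\<in>{1..s}. sinh R1 * gear_angular_velocity G1 r1 f1 t
                   = sinh R2 * gear_angular_velocity G2 r2 f2 t))
     \<and> (\<forall>(s::real) r1 r2.
        pulley_movement c1 s r1 \<and> pulley_movement c2 s r2 \<and>
        belt_no_sliding c1 R1 c2 R2 s r1 r2 \<longrightarrow>
        (\<forall>t\<in>{0..s}. sinh R1 * pulley_angular_velocity c1 R1 s r1 t
                   = sinh R2 * pulley_angular_velocity c2 R2 s r2 t))"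
proof (intro conjI allI impI ballI)
  fix G1 G2 s r1 f1 r2 f2 t
  assume *: "is_gear G1 \<and> gcenter G1 = c1 \<and> gradius G1 = R1 \<and>
        is_gear G2 \<and> gcenter G2 = c2 \<and> gradius G2 = R2 \<and>
        gears_attached G1 G2 \<and> corresponding_movements G1 G2 s r1 f1 r2 f2"
    and t: "t \<in> {1..s}"
  then have n: "0 < gnum G1" "0 < gnum G2" by (auto simp: is_gear_def)
  then have "tooth_length G1 0 = tooth_length G2 0"
    using * by (simp add: gears_attached_def)
  moreover have "gear_winding G1 r1 f1 t = gear_winding G2 r2 f2 t"
    using * t by (simp add: corresponding_movements_def)
  ultimately show "sinh R1 * gear_angular_velocity G1 r1 f1 t = sinh R2 * gear_angular_velocity G2 r2 f2 t"
    using gear_sinh_angular_velocity[of G1 0 r1 f1 t] gear_sinh_angular_velocity[of G2 0 r2 f2 t] * n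
    by simp
next
  fix s :: real and r1 r2 t
  assume *: "pulley_movement c1 s r1 \<and> pulley_movement c2 s r2 \<and> belt_no_sliding c1 R1 c2 R2 s r1 r2"
    and t: "t \<in> {0..s}"
  obtain p1 where p1: "p1 \<in> hcircle c1 R1"
    "sinh R1 * pulley_angular_velocity c1 R1 s r1 t = linear_speed s (\<lambda>t. r1 t p1) t"
    using pulley_sinh_angular_velocity[OF assms(1,3) _ t] * by metis
  obtain p2 where p2: "p2 \<in> hcircle c2 R2"
    "sinh R2 * pulley_angular_velocity c2 R2 s r2 t = linear_speed s (\<lambda>t. r2 t p2) t"
    using pulley_sinh_angular_velocity[OF assms(2,4) _ t] * by metis
  show "sinh R1 * pulley_angular_velocity c1 R1 s r1 t = sinh R2 * pulley_angular_velocity c2 R2 s r2 t"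
    using * p1 p2 t by (simp add: belt_no_sliding_def)
qed

end
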